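(* Let $n,c$ be positive integers and $a\in\{1,\dots,c\}$. Then $$\left|\Pi_n^{eq}\wr C_c(1^a2^a2^a)\right|=B(n)(c-1)^n+B(n)\,n\,(c-1)^{n-1}+\sum_{i=2}^n\sum_{\ell=1}^i\sum_{j=0}^{n-i}\binom{n}{i}\binom{n-i}{j}(i-\ell+1)^jB(n-i-j)(c-1)^{n-i}$$ $$+\sum_{i=2}^n\sum_{\ell=1}^{i-2}\sum_{j=0}^{n-i}\binom{n}{i}\binom{n-i}{j}(i-\ell-1)(i-\ell)^jB(n-i-j)(c-1)^{n-i}.$$
   Context: $\Pi_n\wr C_c$ is the set of colored set partitions of $[n]$: a set partition of $[n]$ together with a color in $\{1,\dots,c\}$ for each element. A colored partition eq-contains $1^a2^a2^a$ iff there are elements $x<y<z$, all colored $a$, with $y$ and $z$ in the same block and $x$ in a different block; $\Pi_n^{eq}\wr C_c(1^a2^a2^a)$ is the set of those that do not. $B(m)$ is the $m$-th Bell number; empty sums are $0$ and $0^0=1$. *)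

theory Defs
  imports "HOL-Library.Disjoint_Sets" "HOL-Library.FuncSet"
begin

definition bell :: "nat \<Rightarrow> nat" where
  "bell m = card {P. partition_on {1..m} P}"

text \<open>A coloured set partition is a pair of a partition of \<open>{1..n}\<close> and a colouring;
  the colouring is extensional, so that distinct pairs are distinct coloured partitions.\<close>

definition colored_partitions :: "nat \<Rightarrow> nat \<Rightarrow> (nat set set \<times> (nat \<Rightarrow> nat)) set" where
  "colored_partitions n c = {P. partition_on {1..n} P} \<times> ({1..n} \<rightarrow>\<^sub>E {1..c})"

definition eq_contains_122 :: "nat \<Rightarrow> nat set set \<times> (nat \<Rightarrow> nat) \<Rightarrow> bool" where
  "eq_contains_122 a \<pi> \<longleftrightarrow>
    (\<exists>x y z. x < y \<and> y < z \<and> snd \<pi> x = a \<and> snd \<pi> y = a \<and> snd \<pi> z = a \<and>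
      (\<exists>X \<in> fst \<pi>. \<exists>Y \<in> fst \<pi>. X \<noteq> Y \<and> x \<in> X \<and> y \<in> Y \<and> z \<in> Y))"

definition eq_avoiders_122 :: "nat \<Rightarrow> nat \<Rightarrow> nat \<Rightarrow> (nat set set \<times> (nat \<Rightarrow> nat)) set" where
  "eq_avoiders_122 n c a = {\<pi> \<in> colored_partitions n c. \<not> eq_contains_122 a \<pi>}"

end

theory Submission
  imports Defs
begin

text \<open>Whether a coloured partition avoids the pattern depends only on its restriction to the set \<open>A\<close> of
  elements coloured \<open>a\<close>. A partition of \<open>A\<close> avoids it iff it is discrete or has a single block with
  several elements, of the form \<open>{x \<in> A. x \<le> y} \<union> {b}\<close> with \<open>y < b\<close> in \<open>A\<close>; so, for every
  \<open>k < card A\<close>, exactly \<open>k\<close> avoiding partitions have \<open>k\<close> blocks. Extending a partition with \<open>k\<close>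
  blocks by \<open>t\<close> new points amounts to choosing the new points that join old blocks, a block for each of
  them, and a partition of the others, which gives \<open>\<Sum>j. (t choose j) * k ^ j * B(t - j)\<close> extensions.\<close>

subsection \<open>Counting\<close>

lemma card_eq_sum_fibres:
  assumes "finite X" "finite Y" "f ` X \<subseteq> Y"
  shows "card X = (\<Sum>y\<in>Y. card {x \<in> X. f x = y})"
  using sum.group[OF assms, of "\<lambda>_. 1::nat"] by simp

lemma sum_Pow_card:
  fixes h :: "nat \<Rightarrow> 'b::semiring_1"
  assumes "finite S"
  shows "(\<Sum>A\<in>Pow S. h (card A)) = (\<Sum>i = 0..card S. of_nat (card S choose i) * h i)"
proof -
  have "(\<Sum>A\<in>Pow S. h (card A)) = (\<Sum>i = 0..card S. \<Sum>A | A \<in> Pow S \<and> card A = i. h (card A))"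
    using assms by (intro sum.group[symmetric]) (auto intro: card_mono)
  also have "\<dots> = (\<Sum>i = 0..card S. of_nat (card S choose i) * h i)"
    using assms by (intro sum.cong) (auto simp: n_subsets)
  finally show ?thesis .
qed

lemma card_colorings_with_class:
  assumes "finite S" "A \<subseteq> S" "finite C" "a \<in> C"
  shows "card {f \<in> S \<rightarrow>\<^sub>E C. {x\<in>S. f x = a} = A} = (card C - 1) ^ (card S - card A)"
proof -
  have "{f \<in> S \<rightarrow>\<^sub>E C. {x\<in>S. f x = a} = A} = (\<Pi>\<^sub>E x\<in>S. if x \<in> A then {a} else C - {a})"
    using assms(2,4) by (auto simp: PiE_iff extensional_def split: if_splits)
  also have "card \<dots> = (\<Prod>x\<in>S. if x \<in> A then 1 else card C - 1)"
    using assms by (subst card_PiE) (auto intro!: prod.cong)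
  also have "\<dots> = (card C - 1) ^ card (S - A)"
    using assms by (simp add: prod.If_cases Diff_eq)
  finally show ?thesis
    using assms by (simp add: card_Diff_subset finite_subset)
qed

subsection \<open>Partitions\<close>

definition block_of :: "'a set set \<Rightarrow> 'a \<Rightarrow> 'a set" where
  "block_of P x = \<Union>{Y\<in>P. x \<in> Y}"

lemma block_of_eq:
  assumes "partition_on A P" "Y \<in> P" "x \<in> Y"
  shows "block_of P x = Y"
proof -
  have "{Z\<in>P. x \<in> Z} = {Y}"
    using assms by (auto simp: partition_on_def disjoint_def)
  then show ?thesis by (simp add: block_of_def)
qed

lemma block_of_mem:
  assumes "partition_on A P" "x \<in> A"
  shows "block_of P x \<in> P" "x \<in> block_of P x"
  using assms block_of_eq[OF assms(1)] by (auto simp: partition_on_def)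

lemma partition_on_Un:
  assumes "partition_on A P" "partition_on B Q" "A \<inter> B = {}"
  shows "partition_on (A \<union> B) (P \<union> Q)"
  using assms disjoint_union[of P Q] by (auto simp: partition_on_def)

lemma partition_on_singleton_iff: "partition_on {x} P \<longleftrightarrow> P = {{x}}"
proof
  assume "partition_on {x} P"
  then have P: "\<Union>P = {x}" "{} \<notin> P" by (auto simp: partition_on_def)
  then have "Y = {x}" if "Y \<in> P" for Y
    using that Union_upper[OF that] subset_singletonD by metis
  then show "P = {{x}}" using P(1) by blast
qed (simp add: partition_on_space)

lemma partition_on_bij_image:
  assumes "bij_betw f A B" "partition_on A P"
  shows "partition_on B ((`) f ` P)"
proof -
  have "{} \<notin> (`) f ` P"
    using partition_onD3[OF assms(2)] by auto
  then show ?thesis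
    using partition_on_inj_image[OF assms(2), of f] assms(1) by (simp add: bij_betw_def)
qed

lemma bij_betw_partitions:
  assumes "bij_betw f A B"
  shows "bij_betw ((`) ((`) f)) {P. partition_on A P} {P. partition_on B P}"
proof (rule bij_betw_byWitness[where f' = "(`) ((`) (inv_into A f))"])
  have "inv_into A f ` f ` X = X" if "partition_on A P" "X \<in> P" for P X
    using that assms Union_upper[OF that(2)]
    by (simp add: bij_betw_def partition_on_def inv_into_image_cancel)
  then show "\<forall>P\<in>{P. partition_on A P}. (`) (inv_into A f) ` (`) f ` P = P"
    by (simp add: image_image cong: image_cong)
  have "f ` inv_into A f ` Y = Y" if "partition_on B P" "Y \<in> P" for P Y
    using that assms Union_upper[OF that(2)]
    by (simp add: bij_betw_def partition_on_def image_inv_into_cancel)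
  then show "\<forall>P\<in>{P. partition_on B P}. (`) f ` (`) (inv_into A f) ` P = P"
    by (simp add: image_image cong: image_cong)
qed (use partition_on_bij_image assms bij_betw_inv_into in blast)+

lemma card_partitions:
  assumes "finite A"
  shows "card {P. partition_on A P} = bell (card A)"
  using ex_bij_betw_nat_finite_1[OF assms] bij_betw_partitions bij_betw_same_card
  unfolding bell_def by metis

subsection \<open>Extending a partition to a larger set\<close>

definition restrict_partition :: "'a set \<Rightarrow> 'a set set \<Rightarrow> 'a set set" where
  "restrict_partition A P = (\<inter>) A ` P - {{}}"

definition extensions :: "'a set \<Rightarrow> 'a set \<Rightarrow> 'a set set \<Rightarrow> 'a set set set" where
  "extensions S A Q = {P. partition_on S P \<and> restrict_partition A P = Q}"

definition attach :: "'a set set \<Rightarrow> 'a set \<Rightarrow> ('a \<Rightarrow> 'a set) \<Rightarrow> 'a set set" where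
  "attach Q T f = (\<lambda>X. X \<union> {x\<in>T. f x = X}) ` Q"

lemma partition_on_restrict_partition:
  assumes "partition_on S P" "A \<subseteq> S"
  shows "partition_on A (restrict_partition A P)"
  using partition_on_restrict[OF assms(1), of A] assms(2)
  by (simp add: restrict_partition_def Int_absorb2)

lemma partition_on_attach:
  assumes "partition_on A Q" "A \<inter> T = {}" "f \<in> T \<rightarrow> Q"
  shows "partition_on (A \<union> T) (attach Q T f)"
proof (rule partition_onI)
  show "\<Union>(attach Q T f) = A \<union> T"
    using assms(1,3) by (auto simp: attach_def partition_on_def)
  show "{} \<notin> attach Q T f"
    using assms(1) by (auto simp: attach_def partition_on_def)
  show "disjnt Y Z" if "Y \<in> attach Q T f" "Z \<in> attach Q T f" "Y \<noteq> Z" for Y Z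
  proof -
    obtain X X' where X: "X \<in> Q" "Y = X \<union> {x\<in>T. f x = X}" "X' \<in> Q" "Z = X' \<union> {x\<in>T. f x = X'}"
      using \<open>Y \<in> attach Q T f\<close> \<open>Z \<in> attach Q T f\<close> unfolding attach_def by blast
    then have "X \<noteq> X'" using \<open>Y \<noteq> Z\<close> by blast
    moreover from this have "X \<inter> X' = {}"
      using X(1,3) partition_onD2[OF assms(1)] by (auto dest: disjointD)
    moreover have "X \<inter> T = {}" "X' \<inter> T = {}"
      using X(1,3) assms(2) partition_onD1[OF assms(1)] by blast+
    ultimately show ?thesis
      unfolding X(2,4) disjnt_def by blast
  qed
qed

lemma restrict_partition_attach_Un:
  assumes "partition_on A Q" "A \<inter> T = {}" "A \<inter> \<Union>R = {}"
  shows "restrict_partition A (attach Q T f \<union> R) = Q"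
proof -
  have "A \<inter> (X \<union> {x\<in>T. f x = X}) = X" if "X \<in> Q" for X
    using that assms(1,2) by (auto simp: partition_on_def)
  then have "(\<inter>) A ` attach Q T f = Q"
    by (simp add: attach_def image_image cong: image_cong)
  moreover have "(\<inter>) A ` R \<subseteq> {{}}"
    using assms(3) by blast
  moreover have "{} \<notin> Q"
    using assms(1) by (rule partition_onD3)
  ultimately show ?thesis
    unfolding restrict_partition_def image_Un by blast
qed

lemma attach_inject:
  assumes "partition_on A Q" "A \<inter> T = {}" "f \<in> T \<rightarrow>\<^sub>E Q" "g \<in> T \<rightarrow>\<^sub>E Q"
    and "attach Q T f = attach Q T g"
  shows "f = g"
proof (rule PiE_ext[OF assms(3,4)])
  have Q: "X \<subseteq> A" if "X \<in> Q" for X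
    using that assms(1) by (auto simp: partition_on_def)
  fix x assume x: "x \<in> T"
  have fx: "f x \<in> Q" using x assms(3) by (auto dest: PiE_mem)
  then have "f x \<union> {y\<in>T. f y = f x} \<in> attach Q T g"
    unfolding assms(5)[symmetric] by (simp add: attach_def)
  then obtain X where X: "X \<in> Q" and block_eq: "f x \<union> {y\<in>T. f y = f x} = X \<union> {y\<in>T. g y = X}"
    by (auto simp: attach_def)
  have "f x = A \<inter> (f x \<union> {y\<in>T. f y = f x})"
    using Q[OF fx] assms(2) by blast
  also have "\<dots> = X"
    unfolding block_eq using Q[OF X] assms(2) by blast
  finally have "f x = X" .
  moreover have "x \<in> X \<union> {y\<in>T. g y = X}"
    unfolding block_eq[symmetric] using x by simp
  moreover have "x \<notin> X" using Q[OF X] x assms(2) by blast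
  ultimately show "f x = g x" by simp
qed

lemma attach_restrict_partition:
  assumes "partition_on S P" and T: "T = {x \<in> S - A. A \<inter> block_of P x \<noteq> {}}"
  shows "attach (restrict_partition A P) T (\<lambda>x\<in>T. A \<inter> block_of P x) = {Y\<in>P. A \<inter> Y \<noteq> {}}"
proof -
  have block: "A \<inter> Y \<union> {x\<in>T. A \<inter> block_of P x = A \<inter> Y} = Y"
    if Y: "Y \<in> {Y\<in>P. A \<inter> Y \<noteq> {}}" for Y
  proof -
    have "x \<in> T \<and> A \<inter> block_of P x = A \<inter> Y \<longleftrightarrow> x \<in> Y - A" for x
    proof
      assume x: "x \<in> T \<and> A \<inter> block_of P x = A \<inter> Y"
      then have mem: "block_of P x \<in> P" "x \<in> block_of P x"
        using block_of_mem[OF assms(1)] by (auto simp: T)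
      obtain z where "z \<in> block_of P x" "z \<in> Y"
        using x Y by blast
      then have "block_of P x = Y"
        using mem(1) Y block_of_eq[OF assms(1)] by (metis (no_types, lifting) mem_Collect_eq)
      then show "x \<in> Y - A"
        using mem(2) x by (simp add: T)
    next
      assume "x \<in> Y - A"
      then show "x \<in> T \<and> A \<inter> block_of P x = A \<inter> Y"
        using Y block_of_eq[OF assms(1), of Y x] partition_onD1[OF assms(1)] by (auto simp: T)
    qed
    then show ?thesis by blast
  qed
  have "restrict_partition A P = (\<inter>) A ` {Y\<in>P. A \<inter> Y \<noteq> {}}"
    by (auto simp: restrict_partition_def)
  then have "attach (restrict_partition A P) T (\<lambda>x\<in>T. A \<inter> block_of P x)
      = (\<lambda>Y. A \<inter> Y \<union> {x\<in>T. A \<inter> block_of P x = A \<inter> Y}) ` {Y\<in>P. A \<inter> Y \<noteq> {}}"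
    by (simp add: attach_def image_image cong: conj_cong)
  also have "\<dots> = (\<lambda>Y. Y) ` {Y\<in>P. A \<inter> Y \<noteq> {}}"
    using block by (rule image_cong[OF refl])
  finally show ?thesis by simp
qed

lemma obtain_attach_Un:
  assumes "partition_on S P"
  obtains T f R where "T \<subseteq> S - A" "f \<in> T \<rightarrow>\<^sub>E restrict_partition A P" "partition_on (S - A - T) R"
    "P = attach (restrict_partition A P) T f \<union> R"
proof -
  note block = block_of_eq[OF assms] block_of_mem[OF assms]
  define T where "T = {x \<in> S - A. A \<inter> block_of P x \<noteq> {}}"
  define R where "R = {Y\<in>P. A \<inter> Y = {}}"
  have "(\<lambda>x\<in>T. A \<inter> block_of P x) \<in> T \<rightarrow>\<^sub>E restrict_partition A P"
    using block(2) by (auto simp: restrict_partition_def T_def)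
  moreover have "partition_on (S - A - T) R"
  proof (rule partition_onI)
    have "\<Union>R = {x\<in>S. A \<inter> block_of P x = {}}"
      using block partition_onD1[OF assms] by (auto simp: R_def)
    then show "\<Union>R = S - A - T"
      using block(3) by (auto simp: T_def)
    show "disjnt Y Z" if "Y \<in> R" "Z \<in> R" "Y \<noteq> Z" for Y Z
      using that disjointD[OF partition_onD2[OF assms]] by (simp add: R_def disjnt_def)
  qed (use partition_onD3[OF assms] in \<open>simp add: R_def\<close>)
  moreover have "P = attach (restrict_partition A P) T (\<lambda>x\<in>T. A \<inter> block_of P x) \<union> R"
    unfolding attach_restrict_partition[OF assms T_def] R_def by blast
  moreover have "T \<subseteq> S - A" by (auto simp: T_def)
  ultimately show thesis using that by blast
qed

lemma attach_Un_blocks: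
  assumes "partition_on A Q" "A \<inter> \<Union>R = {}"
  shows "{Y \<in> attach Q T f \<union> R. A \<inter> Y \<noteq> {}} = attach Q T f"
    and "{Y \<in> attach Q T f \<union> R. A \<inter> Y = {}} = R"
proof -
  have "A \<inter> Y \<noteq> {}" if "Y \<in> attach Q T f" for Y
  proof -
    obtain X where "X \<in> Q" "Y = X \<union> {x\<in>T. f x = X}"
      using \<open>Y \<in> attach Q T f\<close> unfolding attach_def by blast
    moreover from this have "X \<subseteq> A" "X \<noteq> {}"
      using assms(1) by (auto simp: partition_on_def)
    ultimately show ?thesis by blast
  qed
  moreover have "A \<inter> Y = {}" if "Y \<in> R" for Y
    using that assms(2) by blast
  ultimately show "{Y \<in> attach Q T f \<union> R. A \<inter> Y \<noteq> {}} = attach Q T f"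
    and "{Y \<in> attach Q T f \<union> R. A \<inter> Y = {}} = R"
    by blast+
qed

lemma inj_on_attach_Un:
  assumes "partition_on A Q"
  shows "inj_on (\<lambda>(T, f, R). attach Q T f \<union> R)
    (SIGMA T:Pow (S - A). (T \<rightarrow>\<^sub>E Q) \<times> {R. partition_on (S - A - T) R})"
proof (rule inj_onI, clarsimp)
  fix T f R T' f' R'
  assume T: "T \<subseteq> S - A" "T' \<subseteq> S - A" and f: "f \<in> T \<rightarrow>\<^sub>E Q" "f' \<in> T' \<rightarrow>\<^sub>E Q"
    and R: "partition_on (S - A - T) R" "partition_on (S - A - T') R'"
    and eq: "attach Q T f \<union> R = attach Q T' f' \<union> R'"
  have Un_R: "\<Union>R = S - A - T" "\<Union>R' = S - A - T'"
    using R by (simp_all add: partition_on_def)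
  then have disj: "A \<inter> \<Union>R = {}" "A \<inter> \<Union>R' = {}"
    by auto
  have "R = R'"
    using attach_Un_blocks(2)[OF assms disj(1), of T f] attach_Un_blocks(2)[OF assms disj(2), of T' f'] eq
    by simp
  moreover have "attach Q T f = attach Q T' f'"
    using attach_Un_blocks(1)[OF assms disj(1), of T f] attach_Un_blocks(1)[OF assms disj(2), of T' f'] eq
    by simp
  moreover have "T = T'"
    using \<open>R = R'\<close> Un_R T by blast
  moreover have "f = f'"
    using attach_inject[OF assms _ f(1)] f(2) T(1) calculation by blast
  ultimately show "T = T' \<and> f = f' \<and> R = R'"
    by simp
qed

lemma bij_betw_extensions:
  assumes "partition_on A Q" "A \<subseteq> S"
  shows "bij_betw (\<lambda>(T, f, R). attach Q T f \<union> R)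
    (SIGMA T:Pow (S - A). (T \<rightarrow>\<^sub>E Q) \<times> {R. partition_on (S - A - T) R}) (extensions S A Q)"
    (is "bij_betw ?glue ?D _")
proof (rule bij_betw_imageI[OF inj_on_attach_Un[OF assms(1)]], intro equalityI subsetI)
  fix P assume "P \<in> ?glue ` ?D"
  then obtain T f R where T: "T \<subseteq> S - A" and f: "f \<in> T \<rightarrow> Q"
    and R: "partition_on (S - A - T) R" and P: "P = attach Q T f \<union> R"
    by (auto simp: PiE_def)
  have "A \<inter> T = {}" "A \<union> T \<union> (S - A - T) = S"
    using T assms(2) by auto
  moreover have "(A \<union> T) \<inter> (S - A - T) = {}" "A \<inter> \<Union>R = {}"
    using partition_onD1[OF R] by auto
  ultimately show "P \<in> extensions S A Q"
    using partition_on_Un[OF partition_on_attach[OF assms(1) _ f] R]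
      restrict_partition_attach_Un[OF assms(1), of T R f]
    by (simp add: extensions_def P)
next
  fix P assume "P \<in> extensions S A Q"
  then have P: "partition_on S P" "restrict_partition A P = Q"
    by (auto simp: extensions_def)
  obtain T f R where "T \<subseteq> S - A" "f \<in> T \<rightarrow>\<^sub>E Q" "partition_on (S - A - T) R" "P = attach Q T f \<union> R"
    using obtain_attach_Un[OF P(1), of A] unfolding P(2) .
  then show "P \<in> ?glue ` ?D"
    by (intro image_eqI[of _ _ "(T, f, R)"]) simp_all
qed

definition extension_number :: "nat \<Rightarrow> nat \<Rightarrow> nat" where
  "extension_number t k = (\<Sum>j = 0..t. (t choose j) * k ^ j * bell (t - j))"

lemma card_extensions:
  assumes "finite S" "A \<subseteq> S" "partition_on A Q"
  shows "card (extensions S A Q) = extension_number (card S - card A) (card Q)"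
proof -
  let ?U = "S - A"
  have "finite A" using assms(1,2) by (rule finite_subset[rotated])
  then have fin: "finite ?U" "finite Q" and card_U: "card ?U = card S - card A"
    using assms finite_elements by (auto simp: card_Diff_subset)
  have "card (extensions S A Q)
      = card (SIGMA T:Pow ?U. (T \<rightarrow>\<^sub>E Q) \<times> {R. partition_on (?U - T) R})"
    using bij_betw_same_card[OF bij_betw_extensions[OF assms(3,2)]] by simp
  also have "\<dots> = (\<Sum>T\<in>Pow ?U. card ((T \<rightarrow>\<^sub>E Q) \<times> {R. partition_on (?U - T) R}))"
    using fin finite_subset[of _ ?U]
    by (intro card_SigmaI) (auto intro!: finite_cartesian_product finite_PiE finitely_many_partition_on)
  also have "\<dots> = (\<Sum>T\<in>Pow ?U. card Q ^ card T * bell (card ?U - card T))"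
    using fin finite_subset[of _ ?U]
    by (intro sum.cong) (auto simp: card_cartesian_product card_funcsetE card_partitions card_Diff_subset)
  also have "\<dots> = (\<Sum>j = 0..card ?U. (card ?U choose j) * (card Q ^ j * bell (card ?U - j)))"
    using sum_Pow_card[OF fin(1), of "\<lambda>j. card Q ^ j * bell (card ?U - j)"] by simp
  finally show ?thesis
    by (simp add: extension_number_def card_U mult.assoc)
qed

lemma extension_number_0: "extension_number t 0 = bell t"
  unfolding extension_number_def by (subst sum.atLeast_Suc_atMost) simp_all

lemma extension_number_1: "extension_number t 1 = bell (Suc t)"
proof -
  have "restrict_partition {1} P = {{1}}" if "partition_on {1..Suc t} P" for P
    using partition_on_restrict_partition[OF that, of "{1}"] by (simp add: partition_on_singleton_iff)
  then have "extensions {1..Suc t} {1} {{1}} = {P. partition_on {1..Suc t} P}"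
    by (auto simp: extensions_def)
  then show ?thesis
    using card_extensions[of "{1..Suc t}" "{1}" "{{1}}"]
    by (simp add: bell_def partition_on_singleton_iff)
qed

subsection \<open>Avoiding partitions of a colour class\<close>

definition almost_initial :: "'a::linorder set \<Rightarrow> 'a set \<Rightarrow> bool" where
  "almost_initial A B \<longleftrightarrow> (\<forall>y\<in>B. \<forall>z\<in>B. y < z \<longrightarrow> {x\<in>A. x < y} \<subseteq> B)"

definition avoids_122_on :: "'a::linorder set \<Rightarrow> 'a set set \<Rightarrow> bool" where
  "avoids_122_on A P \<longleftrightarrow> (\<forall>Y\<in>P. almost_initial A (A \<inter> Y))"

lemma avoids_122_on_restrict_partition:
  "avoids_122_on A (restrict_partition A P) \<longleftrightarrow> avoids_122_on A P"
proof -
  have "almost_initial A {}" by (simp add: almost_initial_def)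
  then have "(\<forall>Z\<in>\<Q> - {{}}. almost_initial A (A \<inter> Z)) \<longleftrightarrow> (\<forall>Z\<in>\<Q>. almost_initial A (A \<inter> Z))" for \<Q>
    by (metis Diff_iff Int_empty_right singletonD)
  then show ?thesis
    by (simp add: avoids_122_on_def restrict_partition_def)
qed

lemma eq_contains_122_iff_not_avoids_122_on:
  assumes "partition_on {1..n} P"
  shows "eq_contains_122 a (P, f) \<longleftrightarrow> \<not> avoids_122_on {x\<in>{1..n}. f x = a} P"
proof
  let ?A = "{x\<in>{1..n}. f x = a}"
  assume "eq_contains_122 a (P, f)"
  then obtain x y z X Y where xyz: "x < y" "y < z" "f x = a" "f y = a" "f z = a"
    and XY: "X \<in> P" "Y \<in> P" "X \<noteq> Y" "x \<in> X" "y \<in> Y" "z \<in> Y"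
    unfolding eq_contains_122_def fst_conv snd_conv by (elim exE conjE bexE)
  have "x \<notin> Y"
    using XY disjointD[OF partition_onD2[OF assms], of X Y] by blast
  moreover have "x \<in> ?A" "y \<in> ?A \<inter> Y" "z \<in> ?A \<inter> Y"
    using xyz XY partition_onD1[OF assms] by auto
  ultimately have "\<not> almost_initial ?A (?A \<inter> Y)"
    using xyz(1,2) unfolding almost_initial_def by blast
  then show "\<not> avoids_122_on ?A P"
    using XY(2) by (auto simp: avoids_122_on_def)
next
  let ?A = "{x\<in>{1..n}. f x = a}"
  assume "\<not> avoids_122_on ?A P"
  then obtain Y y z x where Y: "Y \<in> P" "y \<in> Y" "z \<in> Y" "x \<notin> Y" and "x < y" "y < z"
    and A: "x \<in> ?A" "y \<in> ?A" "z \<in> ?A"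
    unfolding avoids_122_on_def almost_initial_def by blast
  moreover have "block_of P x \<in> P" "x \<in> block_of P x"
    using A(1) block_of_mem[OF assms] by simp_all
  moreover from this have "block_of P x \<noteq> Y" using Y(4) by blast
  ultimately show "eq_contains_122 a (P, f)"
    unfolding eq_contains_122_def fst_conv snd_conv
    by (intro exI[of _ x] exI[of _ y] exI[of _ z] conjI bexI[of _ "block_of P x"] bexI[of _ Y]) simp_all
qed

lemma card_ge_2_obtains_less:
  fixes B :: "'a::linorder set"
  assumes "2 \<le> card B"
  obtains u v where "u \<in> B" "v \<in> B" "u < v"
proof -
  have "finite B" using assms by (intro card_ge_0_finite) linarith
  moreover have "\<not> card B \<le> Suc 0" using assms by linarith
  ultimately obtain u v where "u \<in> B" "v \<in> B" "u \<noteq> v"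
    unfolding card_le_Suc0_iff_eq[OF \<open>finite B\<close>] by blast
  then show thesis using that by (cases u v rule: linorder_cases) blast+
qed

lemma partition_on_block_singleton:
  assumes "finite A" "partition_on A Q" "C \<in> Q" "\<not> 2 \<le> card C"
  shows "\<exists>x. C = {x}"
proof -
  have "C \<subseteq> A" "C \<noteq> {}"
    using assms(2,3) by (auto simp: partition_on_def)
  moreover from this have "finite C" using assms(1) by (auto intro: finite_subset)
  ultimately have "card C = 1"
    using assms(4) card_gt_0_iff[of C] by linarith
  then show ?thesis using card_1_singletonE by blast
qed

lemma avoiding_large_block_unique:
  assumes "partition_on A Q" "avoids_122_on A Q" "B \<in> Q" "C \<in> Q" "2 \<le> card B" "2 \<le> card C"
  shows "B = C"
proof (rule ccontr)
  assume "B \<noteq> C"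
  then have disj: "B \<inter> C = {}"
    using assms(3,4) disjointD[OF partition_onD2[OF assms(1)]] by blast
  have sub: "B \<subseteq> A" "C \<subseteq> A"
    using assms(3,4) partition_onD1[OF assms(1)] by auto
  then have init: "almost_initial A B" "almost_initial A C"
    using assms(2-4) by (auto simp: avoids_122_on_def Int_absorb1)
  obtain u v where B: "u \<in> B" "v \<in> B" "u < v"
    using assms(5) by (rule card_ge_2_obtains_less)
  obtain p q where C: "p \<in> C" "q \<in> C" "p < q"
    using assms(6) by (rule card_ge_2_obtains_less)
  consider "u < p" | "p < u" | "u = p" by (rule linorder_cases)
  then show False
  proof cases
    case 1
    then have "u \<in> C" using init(2) B C sub by (auto simp: almost_initial_def)
    then show False using B(1) disj by blast
  next
    case 2
    then have "p \<in> B" using init(1) B C sub by (auto simp: almost_initial_def)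
    then show False using C(1) disj by blast
  next
    case 3
    then show False using B(1) C(1) disj by blast
  qed
qed

lemma partition_eq_Un_singletons:
  assumes "partition_on A Q" "R \<subseteq> Q" "\<And>C. C \<in> Q - R \<Longrightarrow> \<exists>x. C = {x}"
  shows "Q = R \<union> (\<lambda>x. {x}) ` (A - \<Union>R)"
proof (intro equalityI subsetI)
  fix C assume C: "C \<in> Q"
  show "C \<in> R \<union> (\<lambda>x. {x}) ` (A - \<Union>R)"
  proof (cases "C \<in> R")
    case False
    then obtain x where x: "C = {x}" using C assms(3) by blast
    have "x \<notin> D" if "D \<in> R" for D
      using that False C x assms(2) disjointD[OF partition_onD2[OF assms(1)], of C D] by auto
    then show ?thesis
      using C x partition_onD1[OF assms(1)] by blast
  qed simp
next
  fix C assume "C \<in> R \<union> (\<lambda>x. {x}) ` (A - \<Union>R)"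
  then consider "C \<in> R" | x where "C = {x}" "x \<in> A" "x \<notin> \<Union>R" by blast
  then show "C \<in> Q"
  proof cases
    case 2
    then obtain D where "D \<in> Q" "x \<in> D" using partition_onD1[OF assms(1)] by blast
    moreover from this have "D = C" using 2 assms(3)[of D] by blast
    ultimately show ?thesis by simp
  qed (use assms(2) in blast)
qed

definition one_block_partition :: "'a set \<Rightarrow> 'a set \<Rightarrow> 'a set set" where
  "one_block_partition A B = insert B ((\<lambda>x. {x}) ` (A - B))"

definition almost_initial_blocks :: "'a::linorder set \<Rightarrow> 'a set set" where
  "almost_initial_blocks A = {B. B \<subseteq> A \<and> 2 \<le> card B \<and> almost_initial A B}"

lemma partition_on_one_block_partition:
  "B \<subseteq> A \<Longrightarrow> B \<noteq> {} \<Longrightarrow> partition_on A (one_block_partition A B)"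
  by (auto simp: one_block_partition_def partition_on_def disjoint_def)

lemma avoids_122_on_one_block_partition:
  assumes "B \<subseteq> A" "almost_initial A B"
  shows "avoids_122_on A (one_block_partition A B)"
  using assms by (auto simp: avoids_122_on_def one_block_partition_def almost_initial_def)

lemma avoids_122_on_singletons: "avoids_122_on A ((\<lambda>x. {x}) ` B)"
  by (auto simp: avoids_122_on_def almost_initial_def)

lemma avoiding_partition_cases:
  fixes A :: "'a::linorder set"
  assumes "finite A" and Q: "partition_on A Q" "avoids_122_on A Q"
  obtains "Q = (\<lambda>x. {x}) ` A"
    | B where "B \<in> almost_initial_blocks A" "Q = one_block_partition A B"
proof (cases "\<exists>B\<in>Q. 2 \<le> card B")
  case False
  then have "\<exists>x. C = {x}" if "C \<in> Q" for C
    using that partition_on_block_singleton[OF assms(1) Q(1)] by blast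
  then have "Q = (\<lambda>x. {x}) ` A"
    using partition_eq_Un_singletons[OF Q(1), of "{}"] by simp
  then show thesis by (rule that)
next
  case True
  then obtain B where B: "B \<in> Q" "2 \<le> card B" by blast
  have "\<exists>x. C = {x}" if "C \<in> Q - {B}" for C
    using that B partition_on_block_singleton[OF assms(1) Q(1), of C] avoiding_large_block_unique[OF Q, of B C]
    by blast
  then have "Q = one_block_partition A B"
    using partition_eq_Un_singletons[OF Q(1), of "{B}"] B(1) by (simp add: one_block_partition_def)
  moreover have "B \<subseteq> A"
    using B(1) partition_onD1[OF Q(1)] by blast
  moreover from this have "almost_initial A B"
    using B(1) Q(2) by (auto simp: avoids_122_on_def Int_absorb1)
  ultimately show thesis
    using B(2) that(2) by (simp add: almost_initial_blocks_def)
qed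

lemma avoiding_partitions_eq:
  fixes A :: "'a::linorder set"
  assumes "finite A"
  shows "{Q. partition_on A Q \<and> avoids_122_on A Q} =
    insert ((\<lambda>x. {x}) ` A) (one_block_partition A ` almost_initial_blocks A)"
proof (intro equalityI subsetI)
  fix Q assume "Q \<in> {Q. partition_on A Q \<and> avoids_122_on A Q}"
  then have "partition_on A Q" "avoids_122_on A Q" by simp_all
  with assms show "Q \<in> insert ((\<lambda>x. {x}) ` A) (one_block_partition A ` almost_initial_blocks A)"
    by (cases rule: avoiding_partition_cases) simp_all
next
  fix Q assume "Q \<in> insert ((\<lambda>x. {x}) ` A) (one_block_partition A ` almost_initial_blocks A)"
  then consider "Q = (\<lambda>x. {x}) ` A"
    | B where "Q = one_block_partition A B" "B \<subseteq> A" "2 \<le> card B" "almost_initial A B"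
    by (auto simp: almost_initial_blocks_def)
  then show "Q \<in> {Q. partition_on A Q \<and> avoids_122_on A Q}"
  proof cases
    case 1
    then show ?thesis
      using partition_on_singletons[of A] avoids_122_on_singletons[of A A] by simp
  next
    case (2 B)
    then have "B \<noteq> {}" by auto
    then show ?thesis
      using 2(2,4) unfolding 2(1)
      by (simp add: partition_on_one_block_partition avoids_122_on_one_block_partition)
  qed
qed

lemma card_one_block_partition:
  assumes "finite A" "B \<subseteq> A" "2 \<le> card B"
  shows "card (one_block_partition A B) = Suc (card A - card B)"
proof -
  have "B \<notin> (\<lambda>x. {x}) ` (A - B)" using assms(3) by auto
  then have "card (one_block_partition A B) = Suc (card (A - B))"
    using assms(1) by (simp add: one_block_partition_def card_image)
  then show ?thesis
    using assms(1,2) by (simp add: card_Diff_subset finite_subset)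
qed

lemma one_block_partition_large_blocks:
  assumes "2 \<le> card B"
  shows "{C \<in> one_block_partition A B. 2 \<le> card C} = {B}"
  using assms by (auto simp: one_block_partition_def)

lemma inj_on_one_block_partition: "inj_on (one_block_partition A) {B. 2 \<le> card B}"
proof (rule inj_onI)
  fix B C :: "'a set"
  assume "B \<in> {B. 2 \<le> card B}" "C \<in> {B. 2 \<le> card B}"
    and eq: "one_block_partition A B = one_block_partition A C"
  then have "{D \<in> one_block_partition A B. 2 \<le> card D} = {B}"
    "{D \<in> one_block_partition A C. 2 \<le> card D} = {C}"
    by (blast intro!: one_block_partition_large_blocks)+
  then show "B = C" unfolding eq by simp
qed

lemma one_block_partition_neq_singletons:
  assumes "2 \<le> card B"
  shows "one_block_partition A B \<noteq> (\<lambda>x. {x}) ` A"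
proof
  assume "one_block_partition A B = (\<lambda>x. {x}) ` A"
  moreover have "B \<in> one_block_partition A B" by (simp add: one_block_partition_def)
  ultimately obtain x where "B = {x}" by blast
  then show False using assms by simp
qed

definition less_pairs :: "'a::linorder set \<Rightarrow> ('a \<times> 'a) set" where
  "less_pairs A = (SIGMA y:A. {b\<in>A. y < b})"

definition segment_with_point :: "'a::linorder set \<Rightarrow> 'a \<times> 'a \<Rightarrow> 'a set" where
  "segment_with_point A = (\<lambda>(y, b). insert b {x\<in>A. x \<le> y})"

lemma inj_on_segment_with_point: "inj_on (segment_with_point A) (less_pairs A)"
proof (rule inj_onI, clarsimp simp: less_pairs_def segment_with_point_def)
  fix y b y' b'
  assume mem: "y \<in> A" "b \<in> A" "y < b" "y' \<in> A" "b' \<in> A" "y' < b'"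
    and "insert b {x\<in>A. x \<le> y} = insert b' {x\<in>A. x \<le> y'}"
  then have eq: "x = b \<or> x \<in> A \<and> x \<le> y \<longleftrightarrow> x = b' \<or> x \<in> A \<and> x \<le> y'" for x
    by blast
  have "b = b'" using eq[of b] eq[of b'] mem by force
  moreover from this have "y = y'" using eq[of y] eq[of y'] mem by force
  ultimately show "y = y' \<and> b = b'" by simp
qed

lemma segment_with_point_in_almost_initial_blocks:
  assumes "finite A" "p \<in> less_pairs A"
  shows "segment_with_point A p \<in> almost_initial_blocks A"
proof -
  obtain y b where p: "p = (y, b)" and mem: "y \<in> A" "b \<in> A" "y < b"
    using assms(2) by (auto simp: less_pairs_def)
  have "card {y, b} \<le> card (segment_with_point A p)"
    using assms(1) mem by (intro card_mono) (auto simp: segment_with_point_def p)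
  then show ?thesis
    using mem by (auto simp: almost_initial_blocks_def almost_initial_def segment_with_point_def p)
qed

lemma almost_initial_blocks_eq:
  fixes A :: "'a::linorder set"
  assumes "finite A"
  shows "almost_initial_blocks A = segment_with_point A ` less_pairs A"
proof (intro equalityI subsetI)
  fix B assume "B \<in> almost_initial_blocks A"
  then have B: "B \<subseteq> A" "2 \<le> card B" "almost_initial A B"
    by (auto simp: almost_initial_blocks_def)
  have "finite B" using B(1) assms by (rule finite_subset)
  define b where "b = Max B"
  define y where "y = Max (B - {b})"
  have "B \<noteq> {}" using B(2) by auto
  then have b: "b \<in> B" "\<And>x. x \<in> B \<Longrightarrow> x \<le> b"
    using \<open>finite B\<close> by (simp_all add: b_def)
  have "card (B - {b}) \<noteq> 0" using B(2) b(1) by simp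
  then have "B - {b} \<noteq> {}" by force
  then have y: "y \<in> B - {b}" "\<And>x. x \<in> B - {b} \<Longrightarrow> x \<le> y"
    using \<open>finite B\<close> unfolding y_def by (intro Max_in Max_ge; simp)+
  have "y < b" using y(1) b(2) by force
  then have "{x\<in>A. x < y} \<subseteq> B"
    using B(3) y(1) b(1) by (auto simp: almost_initial_def)
  then have "B = segment_with_point A (y, b)"
    using y b(1) B(1) by (auto simp: segment_with_point_def order.order_iff_strict)
  moreover have "(y, b) \<in> less_pairs A"
    using \<open>y < b\<close> y(1) b(1) B(1) by (auto simp: less_pairs_def)
  ultimately show "B \<in> segment_with_point A ` less_pairs A" by (rule image_eqI)
qed (use segment_with_point_in_almost_initial_blocks[OF assms] in blast)

lemma card_segment_with_point:
  assumes "finite A" "y \<in> A" "b \<in> A" "y < b"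
  shows "Suc (card A - card (segment_with_point A (y, b))) = card {x\<in>A. y < x}"
proof -
  have "card {x\<in>A. y < x} > 0" using assms by (auto simp: card_gt_0_iff)
  moreover have "card A = card {x\<in>A. x \<le> y} + card {x\<in>A. y < x}"
    using assms(1) by (subst card_Un_disjoint[symmetric]) (auto intro!: arg_cong[of _ _ card])
  ultimately show ?thesis
    using assms(1,4) by (simp add: segment_with_point_def not_le)
qed

lemma sum_card_greater:
  fixes A :: "'a::linorder set" and h :: "nat \<Rightarrow> 'b::comm_monoid_add"
  assumes "finite A"
  shows "(\<Sum>y\<in>A. h (card {x\<in>A. y < x})) = (\<Sum>k<card A. h k)"
  using assms
proof (induction rule: finite_linorder_min_induct)
  case (insert m A)
  have "{x \<in> insert m A. m < x} = A"
    using insert by auto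
  moreover have "{x \<in> insert m A. y < x} = {x\<in>A. y < x}" if "y \<in> A" for y
    using insert that by force
  moreover have "m \<notin> A" using insert by auto
  ultimately show ?case using insert by (simp add: add.commute)
qed simp

lemma sum_almost_initial_blocks:
  fixes A :: "'a::linorder set" and g :: "nat \<Rightarrow> 'b::semiring_1"
  assumes "finite A"
  shows "(\<Sum>B\<in>almost_initial_blocks A. g (Suc (card A - card B))) = (\<Sum>k<card A. of_nat k * g k)"
proof -
  have "(\<Sum>B\<in>almost_initial_blocks A. g (Suc (card A - card B)))
      = (\<Sum>p\<in>less_pairs A. g (Suc (card A - card (segment_with_point A p))))"
    unfolding almost_initial_blocks_eq[OF assms] by (simp add: sum.reindex[OF inj_on_segment_with_point])
  also have "\<dots> = (\<Sum>(y, b)\<in>less_pairs A. g (card {x\<in>A. y < x}))"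
    using card_segment_with_point[OF assms] by (intro sum.cong) (auto simp: less_pairs_def)
  also have "\<dots> = (\<Sum>y\<in>A. \<Sum>b\<in>{b\<in>A. y < b}. g (card {x\<in>A. y < x}))"
    unfolding less_pairs_def using assms by (subst sum.Sigma) auto
  also have "\<dots> = (\<Sum>k<card A. of_nat k * g k)"
    using sum_card_greater[OF assms, of "\<lambda>k. of_nat k * g k"] by simp
  finally show ?thesis .
qed

lemma sum_avoiding_partitions:
  fixes A :: "'a::linorder set" and g :: "nat \<Rightarrow> 'b::semiring_1"
  assumes "finite A"
  shows "(\<Sum>Q | partition_on A Q \<and> avoids_122_on A Q. g (card Q))
    = g (card A) + (\<Sum>k<card A. of_nat k * g k)"
proof -
  have fin: "finite (almost_initial_blocks A)"
    using assms by (simp add: almost_initial_blocks_def)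
  have large: "almost_initial_blocks A \<subseteq> {B. 2 \<le> card B}"
    by (auto simp: almost_initial_blocks_def)
  then have inj: "inj_on (one_block_partition A) (almost_initial_blocks A)"
    using inj_on_one_block_partition by (rule inj_on_subset[rotated])
  have notin: "(\<lambda>x. {x}) ` A \<notin> one_block_partition A ` almost_initial_blocks A"
  proof
    assume "(\<lambda>x. {x}) ` A \<in> one_block_partition A ` almost_initial_blocks A"
    then obtain B where "B \<in> almost_initial_blocks A" "(\<lambda>x. {x}) ` A = one_block_partition A B"
      by (rule imageE)
    then show False
      using large one_block_partition_neq_singletons[of B A] by auto
  qed
  have "(\<Sum>Q | partition_on A Q \<and> avoids_122_on A Q. g (card Q))
      = g (card ((\<lambda>x. {x}) ` A)) + (\<Sum>B\<in>almost_initial_blocks A. g (card (one_block_partition A B)))"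
    unfolding avoiding_partitions_eq[OF assms] using fin notin by (simp add: sum.reindex[OF inj])
  also have "(\<Sum>B\<in>almost_initial_blocks A. g (card (one_block_partition A B)))
      = (\<Sum>B\<in>almost_initial_blocks A. g (Suc (card A - card B)))"
    using assms by (intro sum.cong) (auto simp: almost_initial_blocks_def card_one_block_partition)
  finally show ?thesis
    by (simp add: card_image sum_almost_initial_blocks[OF assms])
qed

subsection \<open>Summing over the colour class\<close>

definition avoiding_extension_number :: "nat \<Rightarrow> nat \<Rightarrow> nat" where
  "avoiding_extension_number t i = extension_number t i + (\<Sum>k<i. k * extension_number t k)"

lemma card_partitions_avoids_122_on:
  fixes A S :: "'a::linorder set"
  assumes "finite S" "A \<subseteq> S"
  shows "card {P. partition_on S P \<and> avoids_122_on A P} =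
    avoiding_extension_number (card S - card A) (card A)"
proof -
  let ?P = "{P. partition_on S P \<and> avoids_122_on A P}"
  let ?Q = "{Q. partition_on A Q \<and> avoids_122_on A Q}"
  have "finite A" using assms by (rule finite_subset[rotated])
  have "finite ?P" "finite ?Q"
    using finitely_many_partition_on[OF assms(1)] finitely_many_partition_on[OF \<open>finite A\<close>] by simp_all
  moreover have "restrict_partition A ` ?P \<subseteq> ?Q"
    using partition_on_restrict_partition[OF _ assms(2)]
    by (auto simp: avoids_122_on_restrict_partition)
  ultimately have "card ?P = (\<Sum>Q\<in>?Q. card {P \<in> ?P. restrict_partition A P = Q})"
    by (rule card_eq_sum_fibres)
  also have "\<dots> = (\<Sum>Q\<in>?Q. extension_number (card S - card A) (card Q))"
  proof (rule sum.cong[OF refl])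
    fix Q assume "Q \<in> ?Q"
    then have "partition_on A Q" "{P \<in> ?P. restrict_partition A P = Q} = extensions S A Q"
      using avoids_122_on_restrict_partition[of A] by (auto simp: extensions_def)
    then show "card {P \<in> ?P. restrict_partition A P = Q} = extension_number (card S - card A) (card Q)"
      using card_extensions[OF assms] by simp
  qed
  finally show ?thesis
    using sum_avoiding_partitions[OF \<open>finite A\<close>, of "extension_number (card S - card A)"]
    by (simp add: avoiding_extension_number_def)
qed

lemma card_colored_avoiding_partitions:
  fixes S :: "'a::linorder set"
  assumes "finite S" "finite C" "a \<in> C"
  shows "card {(P, f). partition_on S P \<and> f \<in> S \<rightarrow>\<^sub>E C \<and> avoids_122_on {x\<in>S. f x = a} P} =
    (\<Sum>i = 0..card S. (card S choose i) *
      (avoiding_extension_number (card S - i) i * (card C - 1) ^ (card S - i)))"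
proof -
  let ?X = "{(P, f). partition_on S P \<and> f \<in> S \<rightarrow>\<^sub>E C \<and> avoids_122_on {x\<in>S. f x = a} P}"
  let ?colour_class = "\<lambda>(P, f). {x\<in>S. f x = a}"
  let ?h = "\<lambda>i. avoiding_extension_number (card S - i) i * (card C - 1) ^ (card S - i)"
  have "?X \<subseteq> {P. partition_on S P} \<times> (S \<rightarrow>\<^sub>E C)" by auto
  then have "finite ?X"
    by (rule finite_subset) (intro finite_cartesian_product finitely_many_partition_on finite_PiE assms)
  moreover have "finite (Pow S)" "?colour_class ` ?X \<subseteq> Pow S"
    using assms(1) by auto
  ultimately have "card ?X = (\<Sum>A\<in>Pow S. card {p \<in> ?X. ?colour_class p = A})"
    by (rule card_eq_sum_fibres)
  also have "\<dots> = (\<Sum>A\<in>Pow S. ?h (card A))"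
  proof (rule sum.cong[OF refl])
    fix A assume "A \<in> Pow S"
    have "{p \<in> ?X. ?colour_class p = A} =
        {P. partition_on S P \<and> avoids_122_on A P} \<times> {f \<in> S \<rightarrow>\<^sub>E C. {x\<in>S. f x = a} = A}"
      by auto
    then show "card {p \<in> ?X. ?colour_class p = A} = ?h (card A)"
      using \<open>A \<in> Pow S\<close> assms
      by (simp add: card_cartesian_product card_partitions_avoids_122_on card_colorings_with_class)
  qed
  also have "\<dots> = (\<Sum>i = 0..card S. (card S choose i) * ?h i)"
    using sum_Pow_card[OF assms(1), of ?h] by simp
  finally show ?thesis .
qed

lemma card_eq_avoiders_122:
  assumes "a \<in> {1..c}"
  shows "card (eq_avoiders_122 n c a) =
    (\<Sum>i = 0..n. (n choose i) * (avoiding_extension_number (n - i) i * (c - 1) ^ (n - i)))"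
proof -
  have "eq_avoiders_122 n c a = {(P, f). partition_on {1..n} P \<and> f \<in> {1..n} \<rightarrow>\<^sub>E {1..c} \<and>
      avoids_122_on {x\<in>{1..n}. f x = a} P}"
    using eq_contains_122_iff_not_avoids_122_on
    by (auto simp: eq_avoiders_122_def colored_partitions_def)
  then show ?thesis
    using card_colored_avoiding_partitions[OF _ _ assms, of "{1..n}"] by simp
qed

lemma avoiding_extension_number_0: "avoiding_extension_number t 0 = bell t"
  by (simp add: avoiding_extension_number_def extension_number_0)

lemma avoiding_extension_number_1: "avoiding_extension_number t 1 = bell (Suc t)"
  using extension_number_1[of t] by (simp add: avoiding_extension_number_def)

text \<open>On the right, \<open>l\<close> is the number of smallest elements of a set of size \<open>i\<close> that share a block. In
  the first sum the block contains nothing else (the partition is discrete for \<open>l = 1\<close>); in the second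
  it also contains one of the \<open>i - l - 1\<close> elements beyond the \<open>(l + 1)\<close>-st.\<close>

lemma sum_by_initial_length:
  fixes g :: "nat \<Rightarrow> 'b::comm_semiring_1"
  assumes "i \<ge> 1"
  shows "g i + (\<Sum>k<i. of_nat k * g k) =
    (\<Sum>l = 1..i. g (i - l + 1)) + (\<Sum>l = 1..i - 2. of_nat (i - l - 1) * g (i - l))"
  using assms
proof (induction i rule: nat_induct_at_least)
  case (Suc i)
  have shift_run: "(\<Sum>l = 1..Suc i. g (Suc i - l + 1)) = g (Suc i) + (\<Sum>l = 1..i. g (i - l + 1))"
    by (subst sum.atLeast_Suc_atMost) (simp_all add: sum.shift_bounds_cl_Suc_ivl del: sum.cl_ivl_Suc)
  have shift_point: "(\<Sum>l = 1..Suc i - 2. of_nat (Suc i - l - 1) * g (Suc i - l))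
      = of_nat (i - 1) * g i + (\<Sum>l = 1..i - 2. of_nat (i - l - 1) * g (i - l))"
  proof (cases "i = 1")
    case False
    then have "Suc i - 2 = Suc (i - 2)" using Suc.hyps by simp
    then show ?thesis
      by (subst sum.atLeast_Suc_atMost) (simp_all add: sum.shift_bounds_cl_Suc_ivl del: sum.cl_ivl_Suc)
  qed simp
  have "of_nat i * g i = g i + of_nat (i - 1) * g i"
    using Suc.hyps by (cases i) (simp_all add: distrib_right)
  then have "g (Suc i) + (\<Sum>k<Suc i. of_nat k * g k)
      = g (Suc i) + of_nat (i - 1) * g i + (g i + (\<Sum>k<i. of_nat k * g k))"
    by (simp only: sum.lessThan_Suc add_ac)
  also have "\<dots> = (\<Sum>l = 1..Suc i. g (Suc i - l + 1))
      + (\<Sum>l = 1..Suc i - 2. of_nat (Suc i - l - 1) * g (Suc i - l))"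
    unfolding Suc.IH shift_run shift_point by (simp only: add_ac)
  finally show ?case .
qed simp

lemma avoiding_extension_number_eq_sum:
  assumes "i \<ge> 1"
  shows "avoiding_extension_number t i =
    (\<Sum>l = 1..i. extension_number t (i - l + 1)) +
    (\<Sum>l = 1..i - 2. (i - l - 1) * extension_number t (i - l))"
  using sum_by_initial_length[OF assms, of "extension_number t"]
  by (simp add: avoiding_extension_number_def)

theorem theorem5p5:
  fixes n c a :: nat
  assumes "n \<ge> 1" and "c \<ge> 1" and "a \<in> {1..c}"
  shows "card (eq_avoiders_122 n c a) =
      bell n * (c - 1) ^ n + bell n * n * (c - 1) ^ (n - 1)
    + (\<Sum>i = 2..n. \<Sum>l = 1..i. \<Sum>j = 0..n - i.
        (n choose i) * ((n - i) choose j) * (i - l + 1) ^ j * bell (n - i - j) * (c - 1) ^ (n - i))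
    + (\<Sum>i = 2..n. \<Sum>l = 1..i - 2. \<Sum>j = 0..n - i.
        (n choose i) * ((n - i) choose j) * (i - l - 1) * (i - l) ^ j * bell (n - i - j) * (c - 1) ^ (n - i))"
proof -
  define T where "T i = (n choose i) * (avoiding_extension_number (n - i) i * (c - 1) ^ (n - i))" for i
  have "T 0 = bell n * (c - 1) ^ n"
    by (simp add: T_def avoiding_extension_number_0)
  moreover have "T 1 = bell n * n * (c - 1) ^ (n - 1)"
    using avoiding_extension_number_1[of "n - 1"] assms(1) by (simp add: T_def)
  moreover have "T i =
      (\<Sum>l = 1..i. \<Sum>j = 0..n - i.
        (n choose i) * ((n - i) choose j) * (i - l + 1) ^ j * bell (n - i - j) * (c - 1) ^ (n - i))
    + (\<Sum>l = 1..i - 2. \<Sum>j = 0..n - i.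
        (n choose i) * ((n - i) choose j) * (i - l - 1) * (i - l) ^ j * bell (n - i - j) * (c - 1) ^ (n - i))"
    if "i \<in> {2..n}" for i
  proof -
    have "i \<ge> 1" using that by simp
    show ?thesis
      unfolding T_def avoiding_extension_number_eq_sum[OF \<open>i \<ge> 1\<close>] extension_number_def
      by (simp only: sum_distrib_left sum_distrib_right distrib_left distrib_right mult_ac)
  qed
  moreover have "sum T {0..n} = T 0 + T 1 + sum T {2..n}"
    using assms(1) by (simp add: sum.atLeast_Suc_atMost numeral_2_eq_2)
  ultimately show ?thesis
    unfolding card_eq_avoiders_122[OF assms(3)] T_def[symmetric] by (simp add: sum.distrib)
qed

end
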